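(* There exists a unique polynomial of degree two $m^{*}:X_{\mathcal S}\to\mathbb R$ such that $m^{*}|_{\mathcal S}=m|_{\mathcal S}$, i.e. $m^{*}([U,\{\theta\}])=m(U)$ for every $U\in\mathcal S$.
   Context: $\mathcal S$ is the family of all non-empty, compact, convex, centrally symmetric ($V=-V$) subsets of $\mathbb R^2$, with Minkowski addition $V+W=\{v+w: v\in V, w\in W\}$ and multiplication $\lambda V=\{\lambda v: v\in V\}$ by scalars $\lambda\ge 0$. Sets with empty interior are allowed; $\theta$ is the origin. The cancellation law $V+W=U+W\Rightarrow V=U$ holds in $\mathcal S$. $X_{\mathcal S}$ is the real vector space $(\mathcal S\times\mathcal S)/\diamond$, where $(U,V)\diamond(P,Q)\iff U+Q=V+P$, with operations $[U,V]+[P,Q]=[U+P,V+Q]$, $\lambda[U,V]=[\lambda U,\lambda V]$ for $\lambda\ge0$, and $(-1)[U,V]=[V,U]$. $\mathcal S$ is regarded as a subset of $X_{\mathcal S}$ via the injective map $U\mapsto[U,\{\theta\}]$. $m$ is the two-dimensional Lebesgue measure on $\mathbb R^2$. A polynomial of degree (at most) two on a real vector space $X$ is a function of the form $x\mapsto b(x,x)+\ell(x)+c$ with $b$ symmetric bilinear, $\ell$ linear and $c\in\mathbb R$ (no topology is involved). *)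

theory Defs
  imports "HOL-Analysis.Analysis"
begin

typedef sbody =
  "{U :: (real^2) set. U \<noteq> {} \<and> compact U \<and> convex U \<and> uminus ` U = U}"
  morphisms set_of_sbody Abs_sbody
  by (rule exI [of _ "{0}"]) simp

setup_lifting type_definition_sbody

lemma minkowski_cancel_subset:
  fixes U V W :: "'a::euclidean_space set"
  assumes "compact U" "convex U" "compact W" "W \<noteq> {}" "V + W \<subseteq> U + W"
  shows "V \<subseteq> U"
proof
  fix z assume z: "z \<in> V"
  show "z \<in> U"
  proof (rule ccontr)
    assume "z \<notin> U"
    then obtain a b where ab: "inner a z < b" "\<And>x. x \<in> U \<Longrightarrow> inner a x > b"
      using separating_hyperplane_closed_point [OF \<open>convex U\<close> compact_imp_closed [OF \<open>compact U\<close>]]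
      by blast
    have "continuous_on W (inner a)"
      by (intro continuous_intros)
    then obtain w where w: "w \<in> W" "\<And>w'. w' \<in> W \<Longrightarrow> inner a w \<le> inner a w'"
      using continuous_attains_inf [OF \<open>compact W\<close> \<open>W \<noteq> {}\<close>] by blast
    have "z + w \<in> U + W"
      using z w assms(5) by blast
    then obtain u w' where "u \<in> U" "w' \<in> W" "z + w = u + w'"
      by (auto elim: set_plus_elim)
    then have "inner a z + inner a w = inner a u + inner a w'" "inner a u > b" "inner a w \<le> inner a w'"
      using ab w by (auto simp flip: inner_add_right)
    then show False
      using ab(1) by linarith
  qed
qed

lemma uminus_set_plus:
  fixes U V :: "'a::ab_group_add set"
  shows "uminus ` (U + V) = uminus ` U + uminus ` V"
  by (force simp: set_plus_def image_iff)

lemma compact_set_plus: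
  fixes U V :: "'a::real_normed_vector set"
  assumes "compact U" "compact V"
  shows "compact (U + V)"
proof -
  have "U + V = {x + y |x y. x \<in> U \<and> y \<in> V}"
    by (auto simp: set_plus_def)
  with compact_sums [OF assms] show ?thesis
    by simp
qed

instantiation sbody :: comm_monoid_add
begin

lift_definition zero_sbody :: sbody is "{0}"
  by simp

lift_definition plus_sbody :: "sbody \<Rightarrow> sbody \<Rightarrow> sbody" is "(+)"
  by (auto simp: uminus_set_plus compact_set_plus convex_set_plus elim!: set_plus_elim)

instance
proof
  fix a b c :: sbody
  show "a + b + c = a + (b + c)"
    by transfer (rule add.assoc)
  show "a + b = b + a"
    by transfer (rule add.commute)
  show "0 + a = a"
    by transfer simp
qed

end

lemma sbody_add_right_cancel:
  fixes U V W :: sbody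
  assumes "V + W = U + W"
  shows "V = U"
  using assms
proof transfer
  fix V W U :: "(real^2) set"
  assume "V \<noteq> {} \<and> compact V \<and> convex V \<and> uminus ` V = V"
    "W \<noteq> {} \<and> compact W \<and> convex W \<and> uminus ` W = W"
    "U \<noteq> {} \<and> compact U \<and> convex U \<and> uminus ` U = U" "V + W = U + W"
  then show "V = U"
    using minkowski_cancel_subset [of U W V] minkowski_cancel_subset [of V W U] by auto
qed

text \<open>
  Only scalars \<open>\<lambda> \<ge> 0\<close> are ever used below; keeping \<open>\<lambda>\<close> unrestricted is harmless, as by
  symmetry the value at \<open>\<lambda>\<close> is that at \<open>\<bar>\<lambda>\<bar>\<close>.
\<close>

lift_definition scale_sbody :: "real \<Rightarrow> sbody \<Rightarrow> sbody" is "\<lambda>c U. (*\<^sub>R) c ` U"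
proof -
  fix c :: real and U :: "(real^2) set"
  assume U: "U \<noteq> {} \<and> compact U \<and> convex U \<and> uminus ` U = U"
  have "uminus ` (*\<^sub>R) c ` U = (*\<^sub>R) c ` uminus ` U"
    by (simp add: image_image)
  with U show "(*\<^sub>R) c ` U \<noteq> {} \<and> compact ((*\<^sub>R) c ` U) \<and> convex ((*\<^sub>R) c ` U) \<and>
      uminus ` (*\<^sub>R) c ` U = (*\<^sub>R) c ` U"
    by (simp add: compact_scaling convex_scaling)
qed

lemma scale_sbody_add: "scale_sbody c (U + V) = scale_sbody c U + scale_sbody c V"
proof transfer
  fix c :: real and U V :: "(real^2) set"
  show "(*\<^sub>R) c ` (U + V) = (*\<^sub>R) c ` U + (*\<^sub>R) c ` V"
    by (force simp: set_plus_def image_iff scaleR_add_right)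
qed

lemma scale_sbody_scale: "scale_sbody c (scale_sbody d U) = scale_sbody (c * d) U"
  by transfer (simp add: image_image)

lemma scale_sbody_one: "scale_sbody 1 U = U"
  by transfer simp

lemma scale_sbody_zero: "scale_sbody 0 U = 0"
  by transfer auto

lemma scale_sbody_plus:
  assumes "0 \<le> c" "0 \<le> d"
  shows "scale_sbody (c + d) U = scale_sbody c U + scale_sbody d U"
  using assms
proof transfer
  fix c d :: real and U :: "(real^2) set"
  assume cd: "0 \<le> c" "0 \<le> d" and "U \<noteq> {} \<and> compact U \<and> convex U \<and> uminus ` U = U"
  then have U: "convex U" "U \<noteq> {}" by auto
  show "(*\<^sub>R) (c + d) ` U = (*\<^sub>R) c ` U + (*\<^sub>R) d ` U"
  proof
    show "(*\<^sub>R) (c + d) ` U \<subseteq> (*\<^sub>R) c ` U + (*\<^sub>R) d ` U"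
      by (auto simp: scaleR_add_left)
    show "(*\<^sub>R) c ` U + (*\<^sub>R) d ` U \<subseteq> (*\<^sub>R) (c + d) ` U"
    proof (cases "c + d = 0")
      case True
      with cd have "c = 0" "d = 0" by auto
      with U show ?thesis by (auto simp: set_plus_def)
    next
      case False
      show ?thesis
      proof
        fix z assume "z \<in> (*\<^sub>R) c ` U + (*\<^sub>R) d ` U"
        then obtain x y where xy: "x \<in> U" "y \<in> U" "z = c *\<^sub>R x + d *\<^sub>R y"
          by (auto elim!: set_plus_elim)
        define w where "w = (c / (c + d)) *\<^sub>R x + (d / (c + d)) *\<^sub>R y"
        have "w \<in> U"
          unfolding w_def using False cd U xy
          by (intro convexD) (auto simp flip: add_divide_distrib)
        moreover have "z = (c + d) *\<^sub>R w"
          using False xy by (simp add: w_def scaleR_add_right)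
        ultimately show "z \<in> (*\<^sub>R) (c + d) ` U"
          by blast
      qed
    qed
  qed
qed

definition diamond :: "sbody \<times> sbody \<Rightarrow> sbody \<times> sbody \<Rightarrow> bool"
  where "diamond = (\<lambda>(U, V) (P, Q). U + Q = V + P)"

lemma diamond_iff [simp]: "diamond (U, V) (P, Q) \<longleftrightarrow> U + Q = V + P"
  by (simp add: diamond_def)

quotient_type sdiff = "sbody \<times> sbody" / diamond
  morphisms rep_sdiff sdiff_class
proof (rule equivpI)
  show "reflp diamond"
    by (auto intro!: reflpI simp: add.commute)
  show "symp diamond"
    by (auto intro!: sympI simp: ac_simps)
  show "transp diamond"
  proof (rule transpI, clarsimp)
    fix U V P Q R S :: sbody
    assume *: "U + Q = V + P" "P + S = Q + R"
    have "(U + S) + (P + Q) = (U + Q) + (P + S)"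
      by (simp add: ac_simps)
    also have "\<dots> = (V + R) + (P + Q)"
      unfolding * by (simp add: ac_simps)
    finally show "U + S = V + R"
      by (rule sbody_add_right_cancel)
  qed
qed

instantiation sdiff :: ab_group_add
begin

lift_definition zero_sdiff :: sdiff is "(0, 0)" .

lift_definition plus_sdiff :: "sdiff \<Rightarrow> sdiff \<Rightarrow> sdiff"
  is "\<lambda>(U, V) (P, Q). (U + P, V + Q)"
proof clarsimp
  fix U V U' V' P Q P' Q' :: sbody
  assume *: "U + V' = V + U'" "P + Q' = Q + P'"
  have "(U + P) + (V' + Q') = (U + V') + (P + Q')"
    by (simp add: ac_simps)
  then show "(U + P) + (V' + Q') = (V + Q) + (U' + P')"
    unfolding * by (simp add: ac_simps)
qed

lift_definition uminus_sdiff :: "sdiff \<Rightarrow> sdiff" is "\<lambda>(U, V). (V, U)"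
  by auto

definition minus_sdiff :: "sdiff \<Rightarrow> sdiff \<Rightarrow> sdiff"
  where "minus_sdiff x y = x + (- y)"

instance
proof
  fix x y z :: sdiff
  show "x + y + z = x + (y + z)"
    by transfer (auto simp: ac_simps)
  show "x + y = y + x"
    by transfer (auto simp: ac_simps)
  show "0 + x = x"
    by transfer (auto simp: ac_simps)
  show "- x + x = 0"
    by transfer (auto simp: ac_simps)
  show "x - y = x + - y"
    by (rule minus_sdiff_def)
qed

end

instantiation sdiff :: real_vector
begin

lift_definition scaleR_sdiff :: "real \<Rightarrow> sdiff \<Rightarrow> sdiff"
  is "\<lambda>c (U, V). if 0 \<le> c then (scale_sbody c U, scale_sbody c V)
               else (scale_sbody (- c) V, scale_sbody (- c) U)"
  by (auto simp flip: scale_sbody_add)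

lemma scaleR_sdiff_uminus: "(- c) *\<^sub>R x = - (c *\<^sub>R x)" for x :: sdiff
proof (transfer fixing: c, clarify)
  fix U V :: sbody
  show "diamond (if 0 \<le> - c then (scale_sbody (- c) U, scale_sbody (- c) V)
      else (scale_sbody (- (- c)) V, scale_sbody (- (- c)) U))
    (case if 0 \<le> c then (scale_sbody c U, scale_sbody c V)
      else (scale_sbody (- c) V, scale_sbody (- c) U) of (U, V) \<Rightarrow> (V, U))"
    by (cases "c = 0") (auto simp: scale_sbody_zero add.commute)
qed

lemma scaleR_sdiff_plus:
  fixes x :: sdiff
  assumes "0 \<le> c" "0 \<le> d"
  shows "(c + d) *\<^sub>R x = c *\<^sub>R x + d *\<^sub>R x"
  using assms by (transfer fixing: c d) (auto simp: scale_sbody_plus ac_simps)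

instance
proof
  fix x y :: sdiff and a b :: real
  show "a *\<^sub>R (x + y) = a *\<^sub>R x + a *\<^sub>R y"
    by transfer (auto simp: scale_sbody_add ac_simps)
  show "1 *\<^sub>R x = x"
    by transfer (auto simp: scale_sbody_one ac_simps)
  show "a *\<^sub>R b *\<^sub>R x = (a * b) *\<^sub>R x"
  proof -
    have nonneg: "a *\<^sub>R b *\<^sub>R x = (a * b) *\<^sub>R x" if "0 \<le> a" "0 \<le> b" for a b and x :: sdiff
      using that by (transfer fixing: a b) (auto simp: scale_sbody_scale add.commute)
    have minus: "a *\<^sub>R (- x) = - (a *\<^sub>R x)" for a and x :: sdiff
      by (transfer fixing: a) (auto simp: add.commute)
    consider "0 \<le> a" "0 \<le> b" | "0 \<le> a" "0 \<le> - b" | "0 \<le> - a" "0 \<le> b" | "0 \<le> - a" "0 \<le> - b"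
      by linarith
    then show ?thesis
      by cases (use nonneg [of a b x] nonneg [of "- a" b x] nonneg [of a "- b" x]
          nonneg [of "- a" "- b" x] in \<open>simp_all add: scaleR_sdiff_uminus minus\<close>)
  qed
  show "(a + b) *\<^sub>R x = a *\<^sub>R x + b *\<^sub>R x"
  proof -
    have mixed: "(a + b) *\<^sub>R x = a *\<^sub>R x + b *\<^sub>R x" if "0 \<le> a" "b < 0" for a b and x :: sdiff
    proof (cases "0 \<le> a + b")
      case True
      with that scaleR_sdiff_plus [of "a + b" "- b" x] show ?thesis
        by (simp add: scaleR_sdiff_uminus)
    next
      case False
      with that have "(- b) *\<^sub>R x = (- (a + b)) *\<^sub>R x + a *\<^sub>R x"
        using scaleR_sdiff_plus [of "- (a + b)" a x] by simp
      then have "- (b *\<^sub>R x) = - ((a + b) *\<^sub>R x) + a *\<^sub>R x"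
        by (simp only: scaleR_sdiff_uminus)
      then show ?thesis
        by (simp add: algebra_simps)
    qed
    have neg: "(a + b) *\<^sub>R x = a *\<^sub>R x + b *\<^sub>R x" if "a < 0" "b < 0"
    proof -
      have "(- (a + b)) *\<^sub>R x = (- a) *\<^sub>R x + (- b) *\<^sub>R x"
        using that scaleR_sdiff_plus [of "- a" "- b" x] by simp
      then have "- ((a + b) *\<^sub>R x) = - (a *\<^sub>R x) + - (b *\<^sub>R x)"
        by (simp only: scaleR_sdiff_uminus)
      then show ?thesis
        by (metis minus_add_distrib neg_equal_iff_equal)
    qed
    show ?thesis
      using scaleR_sdiff_plus [of a b x] mixed [of a b x] mixed [of b a x] neg
      by (cases "0 \<le> a"; cases "0 \<le> b") (simp_all add: add.commute)
  qed
qed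

end

definition sbody_embed :: "sbody \<Rightarrow> sdiff"
  where "sbody_embed U = sdiff_class (U, 0)"

lemma inj_sbody_embed: "inj sbody_embed"
  by (auto intro!: injI simp: sbody_embed_def sdiff.abs_eq_iff)

text \<open>
  ``Degree two'' means degree at most two: \<open>b\<close> and \<open>l\<close> may vanish. Neither is required to be continuous.
\<close>

definition quadratic_polynomial :: "('a::real_vector \<Rightarrow> real) \<Rightarrow> bool"
  where "quadratic_polynomial p \<longleftrightarrow>
    (\<exists>b l c. bilinear b \<and> (\<forall>x y. b x y = b y x) \<and> linear l \<and> (\<forall>x. p x = b x x + l x + c))"

end

theory Submission
  imports Defs
begin

text \<open>
  Existence amounts to bilinearity of \<open>M(X, W) = m(X + W) - m(X) - m(W)\<close> on \<open>\<S>\<close>. If \<open>W\<close> is a segment,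
  Fubini's theorem expresses \<open>M(X, W)\<close> through the support function of \<open>X\<close>, which is linear in \<open>X\<close>;
  the same then holds for sums of segments, since \<open>M(X, Z + I) = M(X, Z) + M(X, I)\<close> for a segment \<open>I\<close>.
  In the plane, every \<open>W \<in> \<S>\<close> is a limit of such zonogons, and
  \<open>m(Y + r Q) = m(Y) + O(r)\<close> for a square \<open>Q\<close> shows that the linearity survives the limit.
  Uniqueness holds because \<open>\<S>\<close> is a cone that spans \<open>X\<^sub>\<S>\<close>.
\<close>

subsection \<open>Adding a segment to a planar convex set\<close>

text \<open>The pair is (height, abscissa), in this order because the outer integral over a product
  measure runs over the first factor: fixing it leaves horizontal sections.\<close>

definition plane_point :: "real \<times> real \<Rightarrow> real^2"
  where "plane_point p = vector [snd p, fst p]"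

lemma plane_point_nth [simp]: "plane_point (y, x) $ 1 = x" "plane_point (y, x) $ 2 = y"
  by (simp_all add: plane_point_def)

lemma plane_point_surj: "plane_point (v $ 2, v $ 1) = v"
  by (simp add: vec_eq_iff forall_2)

lemma continuous_plane_point: "continuous_on S plane_point"
proof -
  have eq: "plane_point = (\<lambda>p. \<chi> i. if i = 1 then snd p else fst p)"
    by (auto simp: fun_eq_iff vec_eq_iff forall_2 plane_point_def)
  have "continuous_on S (\<lambda>p::real\<times>real. if i = 1 then snd p else fst p)" for i :: 2
    by (cases "i = 1") (auto intro!: continuous_intros)
  then show ?thesis
    unfolding eq by (rule continuous_on_vec_lambda)
qed

text \<open>Lebesgue measure is determined by its values on boxes, and \<open>plane_point\<close>
  pulls a box back to a rectangle with the same two side lengths in the other order.\<close>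

lemma distr_plane_point: "distr (lborel \<Otimes>\<^sub>M lborel) borel plane_point = lborel"
proof (rule sym, rule lborel_eqI)
  have meas: "plane_point \<in> borel_measurable (lborel \<Otimes>\<^sub>M lborel)"
    using borel_measurable_continuous_onI [OF continuous_plane_point] by (simp add: lborel_prod)
  fix l u :: "real^2"
  assume *: "\<And>b. b \<in> Basis \<Longrightarrow> l \<bullet> b \<le> u \<bullet> b"
  then have le: "l $ 1 \<le> u $ 1" "l $ 2 \<le> u $ 2"
    using * [of "axis 1 1"] * [of "axis 2 1"] by (auto simp: inner_axis axis_in_Basis_iff)
  have vim: "plane_point -` box l u = {l$2<..<u$2} \<times> {l$1<..<u$1}"
    by (auto simp: mem_box_cart forall_2)
  have Basis: "(Basis :: (real^2) set) = {axis 1 1, axis 2 1}"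
    by (auto simp: Basis_vec_def UNIV_2)
  have B: "(\<Prod>b\<in>Basis. (u - l) \<bullet> b) = (u $ 1 - l $ 1) * (u $ 2 - l $ 2)"
    unfolding Basis by (subst prod.insert) (auto simp: inner_axis axis_eq_axis)
  have "emeasure (distr (lborel \<Otimes>\<^sub>M lborel) borel plane_point) (box l u)
      = emeasure (lborel \<Otimes>\<^sub>M lborel) ({l$2<..<u$2} \<times> {l$1<..<u$1})"
    by (subst emeasure_distr [OF meas]) (simp_all add: vim space_pair_measure)
  also have "\<dots> = ennreal (u$2 - l$2) * ennreal (u$1 - l$1)"
    by (subst lborel.emeasure_pair_measure_Times) (use le in auto)
  also have "\<dots> = (\<Prod>b\<in>Basis. (u - l) \<bullet> b)"
    using le by (simp add: B ennreal_mult' mult.commute)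
  finally show "emeasure (distr (lborel \<Otimes>\<^sub>M lborel) borel plane_point) (box l u)
      = (\<Prod>b\<in>Basis. (u - l) \<bullet> b)" .
qed simp

text \<open>Tonelli's theorem for the pulled-back set. Measurability of the section lengths is
  recorded as well, for splitting the integral of a sum later.\<close>

lemma emeasure_plane_sections:
  fixes S :: "(real^2) set"
  assumes "compact S"
  shows "(\<lambda>y. emeasure lborel ((\<lambda>x. plane_point (y, x)) -` S)) \<in> borel_measurable lborel"
    and "emeasure lborel S = (\<integral>\<^sup>+y. emeasure lborel ((\<lambda>x. plane_point (y, x)) -` S) \<partial>lborel)"
proof -
  have meas: "plane_point \<in> borel_measurable (lborel \<Otimes>\<^sub>M lborel)"
    using borel_measurable_continuous_onI [OF continuous_plane_point] by (simp add: lborel_prod)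
  have S: "S \<in> sets borel" using assms by (simp add: borel_compact)
  have "plane_point -` S \<inter> space (lborel \<Otimes>\<^sub>M lborel) \<in> sets (lborel \<Otimes>\<^sub>M lborel)"
    using meas S by (rule measurable_sets)
  then have v: "plane_point -` S \<in> sets (lborel \<Otimes>\<^sub>M lborel)" by (simp add: space_pair_measure)
  have pv: "Pair y -` plane_point -` S = (\<lambda>x. plane_point (y, x)) -` S" for y by auto
  show "(\<lambda>y. emeasure lborel ((\<lambda>x. plane_point (y, x)) -` S)) \<in> borel_measurable lborel"
    using lborel.measurable_emeasure_Pair [OF v] by (simp add: pv)
  have "emeasure lborel S = emeasure (distr (lborel \<Otimes>\<^sub>M lborel) borel plane_point) S"
    by (simp add: distr_plane_point)
  also have "\<dots> = emeasure (lborel \<Otimes>\<^sub>M lborel) (plane_point -` S)"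
    by (subst emeasure_distr [OF meas S]) (simp add: space_pair_measure)
  also have "\<dots> = (\<integral>\<^sup>+y. emeasure lborel ((\<lambda>x. plane_point (y, x)) -` S) \<partial>lborel)"
    by (subst lborel.emeasure_pair_measure_alt [OF v]) (simp add: pv)
  finally show "emeasure lborel S = (\<integral>\<^sup>+y. emeasure lborel ((\<lambda>x. plane_point (y, x)) -` S) \<partial>lborel)" .
qed

text \<open>Cavalieri's principle: by convexity each section of \<open>Y\<close> at a height in
  \<open>{a..b}\<close> is a compact interval, and the segment lengthens it by \<open>t\<close> at
  both ends. All other sections are empty.\<close>

lemma measure_plus_horizontal_segment:
  fixes Y :: "(real^2) set"
  assumes Y: "compact Y" "convex Y" and "t \<ge> 0" and ab: "(\<lambda>v. v $ 2) ` Y = {a..b}" "a \<le> b"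
  shows "measure lebesgue (Y + closed_segment (axis 1 (- t)) (axis 1 t))
    = measure lebesgue Y + 2 * t * (b - a)"
proof -
  define I :: "(real^2) set" where "I = closed_segment (axis 1 (- t)) (axis 1 t)"
  have I: "v \<in> I \<longleftrightarrow> v $ 2 = 0 \<and> v $ 1 \<in> {-t..t}" for v
  proof -
    have "I = axis 1 ` closed_segment (-t) t"
      unfolding I_def using closed_segment_linear_image [of "axis 1 :: real \<Rightarrow> real^2" "-t" t]
      by (auto simp: linear_iff vec_eq_iff axis_def)
    also have "closed_segment (-t) t = {-t..t}"
      using \<open>t \<ge> 0\<close> by (simp add: closed_segment_eq_real_ivl)
    finally show ?thesis
      by (force simp: vec_eq_iff forall_2 axis_def image_iff)
  qed
  have cI: "compact I" unfolding I_def by simp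
  have cYI: "compact (Y + I)" using Y(1) cI by (rule compact_set_plus)
  let ?s = "\<lambda>S y. (\<lambda>x. plane_point (y, x)) -` S"
  have sec: "emeasure lborel (?s (Y + I) y) = emeasure lborel (?s Y y) + ennreal (2 * t) * indicator {a..b} y"
    for y
  proof (cases "y \<in> {a..b}")
    case False
    have "?s Y y = {}"
    proof -
      have "y \<in> {a..b}" if "plane_point (y, x) \<in> Y" for x
        using imageI [OF that, of "\<lambda>v. v $ 2"] by (simp only: ab(1) plane_point_nth)
      with False show ?thesis by auto
    qed
    moreover have "?s (Y + I) y = {}"
    proof -
      have "y \<in> {a..b}" if "plane_point (y, x) = v + w" "v \<in> Y" "w \<in> I" for x v w
      proof -
        have "v $ 2 = y" using arg_cong [OF that(1), of "\<lambda>v. v $ 2"] that(3) by (simp add: I)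
        then show ?thesis using imageI [OF that(2), of "\<lambda>v. v $ 2"] by (simp only: ab(1))
      qed
      with False show ?thesis by (auto elim!: set_plus_elim)
    qed
    ultimately show ?thesis using False by simp
  next
    case True
    have "y \<in> (\<lambda>v. v $ 2) ` Y" using True by (simp only: ab(1))
    then obtain v where "v \<in> Y" "y = v $ 2" by blast
    then have ne: "?s Y y \<noteq> {}"
      using plane_point_surj [of v] by (auto intro!: exI [of _ "v $ 1"])
    have lin: "plane_point (y, (1 - u) * p + u * q) = (1 - u) *\<^sub>R plane_point (y, p) + u *\<^sub>R plane_point (y, q)" for u p q
      by (auto simp: vec_eq_iff forall_2 algebra_simps)
    have cx: "convex (?s Y y)"
      unfolding convex_alt
    proof clarsimp
      fix p q u assume "plane_point (y, p) \<in> Y" "plane_point (y, q) \<in> Y" "0 \<le> u" "u \<le> (1::real)"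
      then show "plane_point (y, (1 - u) * p + u * q) \<in> Y"
        unfolding lin using Y(2) by (simp add: convex_alt)
    qed
    have co: "continuous_on UNIV (\<lambda>x. plane_point (y, x))"
      by (intro continuous_on_compose2 [OF continuous_plane_point [of UNIV]] continuous_intros) auto
    have cl: "closed (?s Y y)"
      using continuous_closed_vimage compact_imp_closed [OF Y(1)] co
      by (simp add: continuous_on_eq_continuous_within closed_vimage)
    have bd: "bounded (?s Y y)"
    proof (rule bounded_subset)
      show "bounded ((\<lambda>v. v $ 1) ` Y)"
        using Y(1) bounded_component_cart compact_imp_bounded by blast
      show "?s Y y \<subseteq> (\<lambda>v. v $ 1) ` Y"
        by (force simp: image_iff intro!: bexI [of _ "plane_point (y, _)"])
    qed
    obtain c d where cd: "?s Y y = {c..d}"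
      using connected_compact_interval_1 [of "?s Y y"] cx cl bd
      by (auto simp: compact_eq_bounded_closed convex_connected)
    with ne have "c \<le> d" by auto
    have "?s (Y + I) y = {c - t..d + t}"
    proof (rule set_eqI)
      fix x
      have "x \<in> ?s (Y + I) y \<longleftrightarrow> (\<exists>r\<in>{-t..t}. plane_point (y, x - r) \<in> Y)"
      proof
        assume "x \<in> ?s (Y + I) y"
        then obtain v w where vw: "plane_point (y, x) = v + w" "v \<in> Y" "w \<in> I"
          by (auto elim: set_plus_elim)
        have "plane_point (y, x - w $ 1) = v"
          using vw(1) I [of w] vw(3) by (auto simp: vec_eq_iff forall_2)
        then show "\<exists>r\<in>{-t..t}. plane_point (y, x - r) \<in> Y"
          using vw I [of w] by auto
      next
        assume "\<exists>r\<in>{-t..t}. plane_point (y, x - r) \<in> Y"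
        then obtain r where r: "r \<in> {-t..t}" "plane_point (y, x - r) \<in> Y" by blast
        have "plane_point (0, r) \<in> I" using r by (simp add: I)
        moreover have "plane_point (y, x) = plane_point (y, x - r) + plane_point (0, r)"
          by (auto simp: vec_eq_iff forall_2)
        ultimately show "x \<in> ?s (Y + I) y" using r by (auto intro: set_plus_intro)
      qed
      also have "\<dots> \<longleftrightarrow> (\<exists>r\<in>{-t..t}. x - r \<in> {c..d})" by (simp flip: cd)
      also have "\<dots> \<longleftrightarrow> x \<in> {c - t..d + t}"
      proof
        assume x: "x \<in> {c - t..d + t}"
        \<comment> \<open>The witness is the displacement of \<open>x\<close> from its nearest point
          in \<open>{c..d}\<close>.\<close>
        show "\<exists>r\<in>{-t..t}. x - r \<in> {c..d}"
          by (rule bexI [of _ "if x < c then x - c else if x > d then x - d else 0"])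
            (use x \<open>c \<le> d\<close> \<open>t \<ge> 0\<close> in auto)
      qed auto
      finally show "x \<in> ?s (Y + I) y \<longleftrightarrow> x \<in> {c - t..d + t}" .
    qed
    then show ?thesis
      using True cd \<open>c \<le> d\<close> \<open>t \<ge> 0\<close> by (simp flip: ennreal_plus)
  qed
  have "emeasure lborel (Y + I) = (\<integral>\<^sup>+y. emeasure lborel (?s Y y) + ennreal (2 * t) * indicator {a..b} y \<partial>lborel)"
    by (simp add: emeasure_plane_sections(2) [OF cYI] sec)
  also have "\<dots> = emeasure lborel Y + ennreal (2 * t) * ennreal (b - a)"
    using emeasure_plane_sections [OF Y(1)] ab(2)
    by (subst nn_integral_add) (auto simp: nn_integral_cmult_indicator)
  finally have "emeasure lborel (Y + I) = emeasure lborel Y + ennreal (2 * t * (b - a))"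
    using \<open>t \<ge> 0\<close> ab(2) by (simp add: ennreal_mult)
  moreover have "emeasure lborel Y < \<infinity>" using emeasure_compact_finite [OF Y(1)] by simp
  ultimately have "measure lborel (Y + I) = measure lborel Y + 2 * t * (b - a)"
    using \<open>t \<ge> 0\<close> ab(2) unfolding measure_def by (simp add: enn2real_plus)
  moreover have "measure lborel S = measure lebesgue S" if "compact S" for S :: "(real^2) set"
    using that by (simp add: borel_compact measure_completion)
  ultimately show ?thesis using Y(1) cYI by (simp add: I_def)
qed

text \<open>A counterclockwise quarter turn. It gives a normal to \<open>seg a\<close>, kept at the
  length of \<open>a\<close> so that no normalisation enters the area formula.\<close>

definition rot90 :: "real^2 \<Rightarrow> real^2"
  where "rot90 a = vector [- a $ 2, a $ 1]"

lemma inner_vec2: "(x :: real^2) \<bullet> y = x $ 1 * y $ 1 + x $ 2 * y $ 2"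
  by (simp add: inner_vec_def sum_2)

lemma rot90_nth [simp]: "rot90 a $ 1 = - a $ 2" "rot90 a $ 2 = a $ 1"
  by (simp_all add: rot90_def)

lemma rot90_scaleR: "rot90 (c *\<^sub>R a) = c *\<^sub>R rot90 a"
  by (simp add: vec_eq_iff forall_2)

lift_definition seg :: "real^2 \<Rightarrow> sbody" is "\<lambda>a. closed_segment (- a) a"
proof -
  fix a :: "real^2"
  have "uminus ` closed_segment (- a) a = closed_segment (- a) a"
    using closed_segment_linear_image [of uminus "- a" a]
    by (simp add: closed_segment_commute linear_uminus)
  then show "closed_segment (- a) a \<noteq> {} \<and> compact (closed_segment (- a) a) \<and>
      convex (closed_segment (- a) a) \<and> uminus ` closed_segment (- a) a = closed_segment (- a) a"
    by simp
qed

lemma sbody_props: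
  shows "set_of_sbody U \<noteq> {}" "compact (set_of_sbody U)" "convex (set_of_sbody U)"
    "uminus ` set_of_sbody U = set_of_sbody U"
  using set_of_sbody [of U] by auto

lemma sbody_uminus_mem: "x \<in> set_of_sbody U \<Longrightarrow> - x \<in> set_of_sbody U"
  using sbody_props(4) [of U] by blast

subsection \<open>Support functions and area\<close>

definition supp :: "sbody \<Rightarrow> real^2 \<Rightarrow> real"
  where "supp U u = (SUP x\<in>set_of_sbody U. u \<bullet> x)"

text \<open>Compactness and non-emptiness turn the supremum into a maximum, so \<open>supp\<close>
  never takes an unspecified value.\<close>

lemma supp_attained: "\<exists>x\<in>set_of_sbody U. u \<bullet> x = supp U u \<and> (\<forall>y\<in>set_of_sbody U. u \<bullet> y \<le> u \<bullet> x)"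
proof -
  have "continuous_on (set_of_sbody U) ((\<bullet>) u)" by (intro continuous_intros)
  then obtain x where x: "x \<in> set_of_sbody U" "\<forall>y\<in>set_of_sbody U. u \<bullet> y \<le> u \<bullet> x"
    using continuous_attains_sup [OF sbody_props(2,1)] by blast
  then have "supp U u = u \<bullet> x"
    unfolding supp_def by (intro cSup_eq_maximum) auto
  with x show ?thesis by auto
qed

lemma inner_le_supp: "x \<in> set_of_sbody U \<Longrightarrow> u \<bullet> x \<le> supp U u"
  using supp_attained by metis

lemma supp_eqI:
  assumes "x \<in> set_of_sbody U" "u \<bullet> x = s" "\<And>y. y \<in> set_of_sbody U \<Longrightarrow> u \<bullet> y \<le> s"
  shows "supp U u = s"
  using supp_attained [of U u] assms by (metis antisym)

lemma supp_add: "supp (U + V) u = supp U u + supp V u"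
proof -
  obtain x y where "x \<in> set_of_sbody U" "u \<bullet> x = supp U u" "y \<in> set_of_sbody V" "u \<bullet> y = supp V u"
    using supp_attained by metis
  then show ?thesis
    by (intro supp_eqI [of "x + y"])
      (auto simp: plus_sbody.rep_eq inner_add_right inner_le_supp add_mono elim!: set_plus_elim)
qed

lemma supp_zero [simp]: "supp 0 u = 0"
  by (intro supp_eqI [of 0]) (auto simp: zero_sbody.rep_eq)

lemma supp_sum: "supp (sum f I) u = (\<Sum>i\<in>I. supp (f i) u)"
  by (induction I rule: infinite_finite_induct) (auto simp: supp_add)

lemma supp_scale_sbody: "c \<ge> 0 \<Longrightarrow> supp (scale_sbody c U) u = c * supp U u"
proof -
  assume "c \<ge> 0"
  moreover obtain x where "x \<in> set_of_sbody U" "u \<bullet> x = supp U u"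
    using supp_attained by metis
  ultimately show ?thesis
    by (intro supp_eqI [of "c *\<^sub>R x"])
      (auto simp: scale_sbody.rep_eq inner_le_supp mult_left_mono)
qed

lemma supp_uminus: "supp U (- u) = supp U u"
proof -
  obtain x where "x \<in> set_of_sbody U" "u \<bullet> x = supp U u"
    using supp_attained by metis
  then show ?thesis
    using inner_le_supp [OF sbody_uminus_mem, of _ U u]
    by (intro supp_eqI [of "- x"]) (auto simp: sbody_uminus_mem)
qed

text \<open>Positive homogeneity together with central symmetry, which makes the support function
  even; hence the absolute value.\<close>

lemma supp_scaleR: "supp U (c *\<^sub>R u) = \<bar>c\<bar> * supp U u"
proof -
  have *: "supp U (c *\<^sub>R u) = c * supp U u" if "c \<ge> 0" for c
  proof -
    obtain x where "x \<in> set_of_sbody U" "u \<bullet> x = supp U u"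
      using supp_attained by metis
    with that show ?thesis
      by (intro supp_eqI [of x]) (auto simp: inner_le_supp mult_left_mono)
  qed
  show ?thesis
    using * [of c] * [of "- c"] supp_uminus [of U "c *\<^sub>R u"] by (cases "c \<ge> 0") auto
qed

lemma supp_triangle: "supp U (u + v) \<le> supp U u + supp U v"
  using supp_attained [of U "u + v"] inner_le_supp [of _ U u] inner_le_supp [of _ U v]
  by (force simp: inner_add_left intro: order_trans [OF eq_refl add_mono])

lemma supp_nonneg: "0 \<le> supp U u"
  using supp_triangle [of U u "- u"] supp_scaleR [of U 0 u] by (simp add: supp_uminus)

lemma supp_seg: "supp (seg a) u = \<bar>u \<bullet> a\<bar>"
proof (rule supp_eqI [of "if u \<bullet> a \<ge> 0 then a else - a"])
  fix y assume "y \<in> set_of_sbody (seg a)"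
  then obtain t where t: "0 \<le> t" "t \<le> 1" "y = (1 - t) *\<^sub>R (- a) + t *\<^sub>R a"
    unfolding seg.rep_eq in_segment by blast
  then have "u \<bullet> y = (2 * t - 1) * (u \<bullet> a)"
    unfolding t(3) by (simp only: inner_add_right inner_scaleR_right inner_minus_right) (simp add: algebra_simps)
  also have "\<dots> \<le> \<bar>2 * t - 1\<bar> * \<bar>u \<bullet> a\<bar>"
    by (metis abs_ge_self abs_mult)
  also have "\<dots> \<le> 1 * \<bar>u \<bullet> a\<bar>"
    using t by (intro mult_right_mono) auto
  finally show "u \<bullet> y \<le> \<bar>u \<bullet> a\<bar>" by simp
qed (auto simp: seg.rep_eq)

text \<open>A point of \<open>U\<close> outside \<open>V\<close> would be cut off by a hyperplane
  whose normalised normal violates the bound. This turns estimates of support functions into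
  inclusions.\<close>

lemma subset_of_supp_le:
  assumes "\<And>u. norm u = 1 \<Longrightarrow> supp U u \<le> supp V u"
  shows "set_of_sbody U \<subseteq> set_of_sbody V"
proof
  fix z assume z: "z \<in> set_of_sbody U"
  show "z \<in> set_of_sbody V"
  proof (rule ccontr)
    assume "z \<notin> set_of_sbody V"
    then obtain a b where ab: "a \<bullet> z < b" "\<And>x. x \<in> set_of_sbody V \<Longrightarrow> a \<bullet> x > b"
      using separating_hyperplane_closed_point [OF sbody_props(3) compact_imp_closed [OF sbody_props(2)]]
      by blast
    obtain x where x: "x \<in> set_of_sbody V" "- a \<bullet> x = supp V (- a)"
      using supp_attained by metis
    have "a \<noteq> 0" using ab(1) ab(2) [OF x(1)] by auto
    have "supp U (- a) \<le> supp V (- a)"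
      using assms [of "(1 / norm a) *\<^sub>R (- a)"] \<open>a \<noteq> 0\<close>
      by (simp add: supp_scaleR field_simps del: scaleR_minus_right)
    then show False
      using inner_le_supp [OF z, of "- a"] ab(1) ab(2) [OF x(1)] x(2) by simp
  qed
qed

abbreviation (input) area :: "sbody \<Rightarrow> real"
  where "area U \<equiv> measure lebesgue (set_of_sbody U)"

lemma area_mono: "set_of_sbody U \<subseteq> set_of_sbody V \<Longrightarrow> area U \<le> area V"
  by (intro measure_mono_fmeasurable fmeasurableD lmeasurable_compact sbody_props)

lemma area_zero: "area 0 = 0"
  by (simp add: zero_sbody.rep_eq)

lemma area_scale: "area (scale_sbody c U) = c\<^sup>2 * area U"
  using measure_lebesgue_affine [of c 0 "set_of_sbody U"] by (simp add: scale_sbody.rep_eq)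

text \<open>Convexity gives \<open>U + U = scale_sbody 2 U\<close>. This is what evaluates the
  polarised area on the diagonal.\<close>

lemma area_double: "area (U + U) = 4 * area U"
  using scale_sbody_plus [of 1 1 U] area_scale [of 2 U] by (simp add: scale_sbody_one)

text \<open>After a rotation \<open>a\<close> is horizontal. The added area is the length
  \<open>2 * norm a\<close> of the segment times the width
  \<open>2 * supp Y (rot90 a) / norm a\<close> of \<open>Y\<close> across it.\<close>

lemma area_add_seg: "area (Y + seg a) = area Y + 4 * supp Y (rot90 a)"
proof (cases "a = 0")
  case True
  then have "seg a = 0" by (simp add: seg_def zero_sbody_def)
  then show ?thesis using True supp_scaleR [of Y 0] rot90_scaleR [of 0 a] by simp
next
  case False
  \<comment> \<open>Coordinates in the orthonormal frame along \<open>a\<close> and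
    \<open>rot90 a\<close>; \<open>h\<close> below is the half-width of \<open>Y\<close> across
    \<open>a\<close>. Both divide by \<open>norm a\<close>, whence the separate case
    \<open>a = 0\<close>.\<close>
  define f :: "real^2 \<Rightarrow> real^2" where "f x = (1 / norm a) *\<^sub>R vector [a \<bullet> x, rot90 a \<bullet> x]" for x
  define h where "h = supp Y (rot90 a) / norm a"
  have na: "norm a > 0" using False by simp
  have f_nth [simp]: "f x $ 1 = (a \<bullet> x) / norm a" "f x $ 2 = (rot90 a \<bullet> x) / norm a" for x
    by (simp_all add: f_def)
  have lin: "linear f"
    by (auto simp: linear_iff vec_eq_iff forall_2 inner_add_right add_divide_distrib)
  have "norm (f x) = norm x" for x
  proof -
    have "(norm (f x))\<^sup>2 = ((a \<bullet> x)\<^sup>2 + (rot90 a \<bullet> x)\<^sup>2) / (norm a)\<^sup>2"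
      unfolding power2_norm_eq_inner [of "f x"] inner_vec2 [of "f x"] f_nth
      by (simp add: add_divide_distrib power2_eq_square)
    also have "(a \<bullet> x)\<^sup>2 + (rot90 a \<bullet> x)\<^sup>2 = (norm a)\<^sup>2 * (norm x)\<^sup>2"
      unfolding power2_norm_eq_inner by (simp add: inner_vec2 power2_eq_square algebra_simps)
    finally show ?thesis using na by simp
  qed
  then have orth: "orthogonal_transformation f"
    using lin by (simp add: orthogonal_transformation)
  have fa: "f a = axis 1 (norm a)"
    by (auto simp: vec_eq_iff forall_2 axis_def dot_square_norm power2_eq_square inner_vec2 [of "rot90 a"])
  have fma: "f (- a) = axis 1 (- norm a)"
    by (auto simp: linear_neg [OF lin] fa vec_eq_iff axis_def)
  let ?Y = "set_of_sbody Y"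
  have "f ` (?Y + closed_segment (- a) a) = f ` ?Y + f ` closed_segment (- a) a"
    using linear_add [OF lin] by (force simp: set_plus_def image_iff)
  also have "f ` closed_segment (- a) a = closed_segment (axis 1 (- norm a)) (axis 1 (norm a))"
    using closed_segment_linear_image [OF lin, of "- a" a] by (simp add: fa fma)
  finally have im: "f ` (?Y + closed_segment (- a) a)
    = f ` ?Y + closed_segment (axis 1 (- norm a)) (axis 1 (norm a))" .
  have cf: "compact (f ` ?Y)" "convex (f ` ?Y)"
    using lin by (auto intro!: compact_continuous_image convex_linear_image linear_continuous_on
      simp: sbody_props linear_linear)
  \<comment> \<open>Symmetry supplies both endpoints, convexity the heights between them.\<close>
  have proj: "(\<lambda>v. v $ 2) ` f ` ?Y = {- h..h}"
  proof
    have "\<bar>f x $ 2\<bar> \<le> h" if "x \<in> ?Y" for x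
      using inner_le_supp [OF that, of "rot90 a"] inner_le_supp [OF sbody_uminus_mem [OF that], of "rot90 a"] na
      by (simp add: h_def divide_right_mono abs_le_iff flip: minus_divide_left)
    then show "(\<lambda>v. v $ 2) ` f ` ?Y \<subseteq> {- h..h}"
      unfolding image_image image_subset_iff by (metis abs_le_iff atLeastAtMost_iff minus_le_iff)
    obtain x where x: "x \<in> ?Y" "rot90 a \<bullet> x = supp Y (rot90 a)"
      using supp_attained by metis
    have "linear (\<lambda>v :: real^2. v $ 2)" by (auto simp: linear_iff)
    then have cv: "convex ((\<lambda>v. v $ 2) ` f ` ?Y)" using cf(2) by (rule convex_linear_image)
    have "h \<in> (\<lambda>v. v $ 2) ` f ` ?Y"
      using x by (force simp: h_def image_iff)
    moreover have "- h \<in> (\<lambda>v. v $ 2) ` f ` ?Y"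
      using x by (auto simp: h_def image_iff intro!: bexI [of _ "- x"] sbody_uminus_mem)
    ultimately have "closed_segment (- h) h \<subseteq> (\<lambda>v. v $ 2) ` f ` ?Y"
      using cv unfolding convex_contains_segment by blast
    moreover have "0 \<le> h" by (simp add: h_def supp_nonneg)
    ultimately show "{- h..h} \<subseteq> (\<lambda>v. v $ 2) ` f ` ?Y" by (simp add: closed_segment_eq_real_ivl)
  qed
  have "area (Y + seg a) = measure lebesgue (f ` (?Y + closed_segment (- a) a))"
    using measure_orthogonal_image [OF orth, of "?Y + closed_segment (- a) a"]
    by (simp add: plus_sbody.rep_eq seg.rep_eq lmeasurable_compact compact_set_plus sbody_props)
  also have "\<dots> = measure lebesgue (f ` ?Y) + 2 * norm a * (h - - h)"
    unfolding im by (rule measure_plus_horizontal_segment [OF cf _ proj])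
      (auto simp: h_def supp_nonneg)
  also have "measure lebesgue (f ` ?Y) = area Y"
    using measure_orthogonal_image [OF orth, of ?Y] by (simp add: lmeasurable_compact sbody_props)
  also have "2 * norm a * (h - - h) = 4 * supp Y (rot90 a)"
    using na by (simp add: h_def)
  finally show ?thesis .
qed

subsection \<open>Mixed areas and zonogons\<close>

text \<open>Twice the classical mixed area of two planar convex bodies.\<close>

definition mixed :: "sbody \<Rightarrow> sbody \<Rightarrow> real"
  where "mixed U V = area (U + V) - area U - area V"

lemma mixed_commute: "mixed U V = mixed V U"
  by (simp add: mixed_def add.commute)

definition linear_mixed :: "sbody \<Rightarrow> bool"
  where "linear_mixed W \<longleftrightarrow> (\<forall>X Y. mixed (X + Y) W = mixed X W + mixed Y W) \<and>
    (\<forall>c\<ge>0. \<forall>X. mixed (scale_sbody c X) W = c * mixed X W)"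

text \<open>Apply \<open>area_add_seg\<close> to \<open>X + Z\<close> and to \<open>Z\<close>:
  support functions add, so the contribution of \<open>Z\<close> cancels and what remains is linear
  in \<open>X\<close>.\<close>

lemma mixed_add_seg: "mixed X (Z + seg a) = mixed X Z + 4 * supp X (rot90 a)"
  using area_add_seg [of "X + Z" a] area_add_seg [of Z a]
  by (simp add: mixed_def supp_add add.assoc)

lemma linear_mixed_sum_seg: "linear_mixed (\<Sum>i\<in>I. seg (f i))"
proof (induction I rule: infinite_finite_induct)
  case (insert i I)
  then show ?case
    by (simp add: add.commute [of "seg (f i)"] linear_mixed_def mixed_add_seg supp_add
        supp_scale_sbody distrib_left)
\<comment> \<open>An empty or infinite index set gives the sum \<open>0\<close>, and
  \<open>mixed X 0\<close> vanishes.\<close>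
qed (simp_all add: linear_mixed_def mixed_def area_zero)

lemma linear_mixed_limit:
  assumes Z: "\<And>n. linear_mixed (Z n)"
    and lim: "\<And>X. (\<lambda>n. area (X + Z n)) \<longlonglongrightarrow> area (X + W)"
  shows "linear_mixed W"
proof -
  \<comment> \<open>The instance of \<open>lim\<close> at the body \<open>0\<close> yields
    convergence of \<open>area (Z n)\<close> itself.\<close>
  have M: "(\<lambda>n. mixed X (Z n)) \<longlonglongrightarrow> mixed X W" for X
    unfolding mixed_def using lim [of 0] by (intro tendsto_intros lim) simp
  show ?thesis
    unfolding linear_mixed_def
  proof (intro conjI allI impI)
    fix X Y
    have "(\<lambda>n. mixed (X + Y) (Z n)) \<longlonglongrightarrow> mixed X W + mixed Y W"
      using tendsto_add [OF M [of X] M [of Y]] Z by (simp add: linear_mixed_def)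
    with M show "mixed (X + Y) W = mixed X W + mixed Y W"
      by (rule LIMSEQ_unique)
  next
    fix X and c :: real assume "0 \<le> c"
    then have "(\<lambda>n. mixed (scale_sbody c X) (Z n)) \<longlonglongrightarrow> c * mixed X W"
      using tendsto_mult_left [OF M [of X], of c] Z by (simp add: linear_mixed_def)
    with M show "mixed (scale_sbody c X) W = c * mixed X W"
      by (rule LIMSEQ_unique)
  qed
qed

section \<open>Zonogons that interpolate a support function\<close>

definition dir :: "real \<Rightarrow> real^2"
  where "dir t = vector [cos t, sin t]"

lemma dir_nth [simp]: "dir t $ 1 = cos t" "dir t $ 2 = sin t"
  by (simp_all add: dir_def)

text \<open>Hence \<open>seg (rot90 (dir t))\<close> has the support value
  \<open>\<bar>sin (s - t)\<bar>\<close> in direction \<open>dir s\<close>.\<close>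

lemma inner_dir_rot90_dir: "dir s \<bullet> rot90 (dir t) = sin (s - t)"
  by (simp add: inner_vec2 sin_diff)

lemma dir_plus_pi: "dir (t + pi) = - dir t"
  by (simp add: vec_eq_iff forall_2)

lemma dir_add_dir: "dir (t - d) + dir (t + d) = (2 * cos d) *\<^sub>R dir t"
  by (simp add: vec_eq_iff forall_2 cos_add cos_diff sin_add sin_diff)

text \<open>A chord, of length \<open>2 * \<bar>sin ((s - t) / 2)\<bar>\<close>, is no longer than
  its arc.\<close>

lemma norm_dir_diff: "norm (dir s - dir t) \<le> \<bar>s - t\<bar>"
proof -
  have "(norm (dir s - dir t))\<^sup>2 = (cos s - cos t)\<^sup>2 + (sin s - sin t)\<^sup>2"
    unfolding power2_norm_eq_inner inner_vec2 by (simp add: power2_eq_square)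
  also have "\<dots> = ((sin s)\<^sup>2 + (cos s)\<^sup>2) + ((sin t)\<^sup>2 + (cos t)\<^sup>2) - 2 * cos (s - t)"
    by (simp only: cos_diff) (simp add: power2_eq_square algebra_simps)
  also have "\<dots> = 2 - 2 * cos (2 * ((s - t) / 2))"
    by (simp only: sin_cos_squared_add times_divide_eq_right nonzero_mult_div_cancel_left)
  also have "\<dots> = (2 * \<bar>sin ((s - t) / 2)\<bar>)\<^sup>2"
    by (simp only: cos_double_sin) (simp add: power2_eq_square)
  also have "\<dots> \<le> (\<bar>s - t\<bar>)\<^sup>2"
    using abs_sin_x_le_abs_x [of "(s - t) / 2"] by (intro power_mono) auto
  finally show ?thesis
    by (rule power2_le_imp_le) simp
qed

text \<open>Telescoping in two blocks: the sign change at \<open>j\<close> leaves the inner boundary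
  value twice.\<close>

lemma sum_telescope_sign:
  fixes D :: "nat \<Rightarrow> real"
  shows "(\<Sum>k<N. (if k < j then -1 else 1) * (D (Suc k) - D k))
    = (if N \<le> j then D 0 - D N else D N - 2 * D j + D 0)"
  by (induction N) (auto simp: not_le less_Suc_eq le_less)

text \<open>
  The coefficients \<open>c\<close> below are second differences of the support function, adapted to the kernel
  \<open>span {cos, sin}\<close> of \<open>h + h''\<close>; since a sum of segments with normals \<open>dir (k \<delta>)\<close> has support
  function \<open>\<Sum>k. c k * \<bar>sin (t - k \<delta>)\<bar>\<close>, summation by parts gives back the values at the nodes.
\<close>

lemma zonogon_interpolation:
  assumes "2 \<le> N"
  defines "\<delta> \<equiv> pi / real N"
  obtains Z where "linear_mixed Z" "\<And>j. j \<le> N \<Longrightarrow> supp Z (dir (real j * \<delta>)) = supp W (dir (real j * \<delta>))"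
proof -
  have \<delta>: "0 < \<delta>" "\<delta> < pi" and N\<delta>: "real N * \<delta> = pi"
    using assms by (auto simp: \<delta>_def field_simps)
  then have sin\<delta>: "0 < sin \<delta>" by (intro sin_gt_zero)
  \<comment> \<open>Real indices keep \<open>x - 1\<close> meaningful at the first node.\<close>
  define A where "A x = supp W (dir (x * \<delta>))" for x
  define c where "c x = (A (x - 1) + A (x + 1) - 2 * cos \<delta> * A x) / (2 * sin \<delta>)" for x
  define Z where "Z = (\<Sum>k<N. seg (c (real k) *\<^sub>R rot90 (dir (real k * \<delta>))))"
  \<comment> \<open>Subadditivity of the support function, applied to \<open>dir_add_dir\<close>.
    Nonnegativity lets \<open>c\<close> leave the absolute value in \<open>supp_seg\<close>.\<close>
  have c_nonneg: "0 \<le> c x" for x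
  proof -
    have "2 * cos \<delta> * A x \<le> \<bar>2 * cos \<delta>\<bar> * A x"
      by (intro mult_right_mono) (auto simp: A_def supp_nonneg)
    also have "\<dots> = supp W (dir (x * \<delta> - \<delta>) + dir (x * \<delta> + \<delta>))"
      by (simp only: dir_add_dir supp_scaleR A_def)
    also have "\<dots> \<le> A (x - 1) + A (x + 1)"
      using supp_triangle [of W "dir (x * \<delta> - \<delta>)" "dir (x * \<delta> + \<delta>)"]
      by (simp add: A_def algebra_simps)
    finally show ?thesis
      using sin\<delta> by (simp add: c_def)
  qed
  have "supp Z (dir (real j * \<delta>)) = supp W (dir (real j * \<delta>))" if "j \<le> N" for j
  proof -
    define s where "s x = sin ((x - real j) * \<delta>)" for x
    \<comment> \<open>A discrete Wronskian of \<open>A\<close> and \<open>s\<close>: since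
      \<open>s\<close> obeys the recurrence \<open>s_rec\<close>, the increments of \<open>D\<close>
      are the products \<open>c x * s x\<close> up to the factor
      \<open>2 * sin \<delta>\<close>.\<close>
    define D where "D x = A x * s (x - 1) - A (x - 1) * s x" for x
    have s_rec: "s (x - 1) + s (x + 1) = 2 * cos \<delta> * s x" for x
    proof -
      have "(x - 1 - real j) * \<delta> = (x - real j) * \<delta> - \<delta>" "(x + 1 - real j) * \<delta> = (x - real j) * \<delta> + \<delta>"
        by (simp_all add: algebra_simps)
      then show ?thesis by (simp add: s_def sin_add sin_diff)
    qed
    have D_step: "2 * sin \<delta> * c x * s x = D (x + 1) - D x" for x
    proof -
      have "2 * sin \<delta> * c x * s x = (A (x - 1) + A (x + 1)) * s x - A x * (2 * cos \<delta> * s x)"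
      proof -
        have "2 * sin \<delta> * c x = A (x - 1) + A (x + 1) - 2 * cos \<delta> * A x"
          using sin\<delta> by (simp add: c_def)
        then show ?thesis by (simp add: left_diff_distrib)
      qed
      also have "\<dots> = D (x + 1) - D x"
        by (subst s_rec [symmetric]) (simp add: D_def algebra_simps)
      finally show ?thesis .
    qed
    \<comment> \<open>Node angles differ by at most \<open>pi\<close>, so the sine changes sign only
      at \<open>k = j\<close>.\<close>
    have sgn: "\<bar>s (real k)\<bar> = (if k < j then -1 else 1) * s (real k)" if "k < N" for k
    proof (cases "k < j")
      case True
      have "(real j - real k) * \<delta> \<le> real N * \<delta>"
        using \<open>j \<le> N\<close> \<delta> by (intro mult_right_mono) auto
      then have "0 \<le> sin ((real j - real k) * \<delta>)"
        using True \<delta> by (intro sin_ge_zero) (auto simp: N\<delta>)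
      moreover have "s (real k) = - sin ((real j - real k) * \<delta>)"
        by (simp add: s_def algebra_simps flip: sin_minus)
      ultimately show ?thesis using True by simp
    next
      case False
      have "(real k - real j) * \<delta> \<le> real N * \<delta>"
        using \<open>k < N\<close> \<delta> by (intro mult_right_mono) auto
      then have "0 \<le> s (real k)"
        unfolding s_def using False \<delta> by (intro sin_ge_zero) (auto simp: N\<delta>)
      then show ?thesis using False by simp
    qed
    have "2 * sin \<delta> * supp Z (dir (real j * \<delta>)) = (\<Sum>k<N. 2 * sin \<delta> * c (real k) * \<bar>s (real k)\<bar>)"
    proof -
      have "supp (seg (c (real k) *\<^sub>R rot90 (dir (real k * \<delta>)))) (dir (real j * \<delta>)) = c (real k) * \<bar>s (real k)\<bar>" for k
      proof -
        have "\<bar>sin (real j * \<delta> - real k * \<delta>)\<bar> = \<bar>s (real k)\<bar>"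
          using sin_minus [of "(real k - real j) * \<delta>"] by (simp add: s_def algebra_simps)
        then show ?thesis
          using c_nonneg by (simp add: supp_seg inner_dir_rot90_dir abs_mult)
      qed
      then show ?thesis by (simp add: Z_def supp_sum sum_distrib_left mult.assoc)
    qed
    also have "\<dots> = (\<Sum>k<N. (if k < j then -1 else 1) * (D (real (Suc k)) - D (real k)))"
    proof (rule sum.cong [OF refl])
      fix k assume "k \<in> {..<N}"
      then have "2 * sin \<delta> * c (real k) * \<bar>s (real k)\<bar>
          = (if k < j then -1 else 1) * (2 * sin \<delta> * c (real k) * s (real k))"
        using sgn [of k] by simp
      also have "2 * sin \<delta> * c (real k) * s (real k) = D (real (Suc k)) - D (real k)"
        using D_step [of "real k"] by (simp add: add.commute)
      finally show "2 * sin \<delta> * c (real k) * \<bar>s (real k)\<bar>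
          = (if k < j then -1 else 1) * (D (real (Suc k)) - D (real k))" .
    qed
    also have "\<dots> = D (real N) - 2 * D (real j) + D 0"
      using \<open>j \<le> N\<close> by (subst sum_telescope_sign) auto
    \<comment> \<open>A shift by \<open>N\<close> is a half turn: it preserves \<open>A\<close> by
      central symmetry and negates \<open>s\<close>. The outer boundary terms cancel and only
      \<open>D (real j)\<close> survives.\<close>
    also have "D (real N) = - D 0"
    proof -
      have A: "A (x + real N) = A x" for x
        using supp_uminus [of W "dir (x * \<delta>)"] by (simp add: A_def distrib_right N\<delta> dir_plus_pi)
      have s: "s (x + real N) = - s x" for x
      proof -
        have "(x + real N - real j) * \<delta> = (x - real j) * \<delta> + pi"
          unfolding N\<delta> [symmetric] by (simp add: algebra_simps)
        then show ?thesis by (simp add: s_def)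
      qed
      show ?thesis
        using A [of 0] A [of "-1"] s [of 0] s [of "-1"] by (simp add: D_def)
    qed
    also have "D (real j) = - sin \<delta> * A (real j)"
      by (simp add: D_def s_def)
    finally show ?thesis
      using sin\<delta> by (simp add: A_def)
  qed
  moreover have "linear_mixed Z" unfolding Z_def by (rule linear_mixed_sum_seg)
  ultimately show ?thesis using that by blast
qed

section \<open>Quantitative approximation of support functions and areas\<close>

definition frame_width :: "sbody \<Rightarrow> real"
  where "frame_width U = supp U (axis 1 1) + supp U (axis 2 1)"

text \<open>Combined with subadditivity, this makes \<open>frame_width U\<close> a Lipschitz
  constant of \<open>supp U\<close> that depends on two support values only.\<close>

lemma supp_le_frame_width: "supp U u \<le> frame_width U * norm u"
proof -
  have "supp U u = supp U (u $ 1 *\<^sub>R axis 1 1 + u $ 2 *\<^sub>R axis 2 1)"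
    by (rule arg_cong [of _ _ "supp U"]) (simp add: vec_eq_iff forall_2 axis_def)
  also have "\<dots> \<le> \<bar>u $ 1\<bar> * supp U (axis 1 1) + \<bar>u $ 2\<bar> * supp U (axis 2 1)"
    using supp_triangle [of U "u $ 1 *\<^sub>R axis 1 1" "u $ 2 *\<^sub>R axis 2 1"] by (simp add: supp_scaleR)
  also have "\<dots> \<le> norm u * supp U (axis 1 1) + norm u * supp U (axis 2 1)"
    by (intro add_mono mult_right_mono component_le_norm_cart supp_nonneg)
  finally show ?thesis by (simp add: frame_width_def algebra_simps)
qed

text \<open>For \<open>r \<ge> 0\<close> it contains the disc of radius \<open>r\<close> and serves
  in its place: being a sum of two segments, it changes areas by an explicit formula.\<close>

definition square :: "real \<Rightarrow> sbody"
  where "square r = seg (axis 1 r) + seg (axis 2 r)"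

lemma supp_square_ge:
  assumes "0 \<le> r" "norm u = 1"
  shows "r \<le> supp (square r) u"
proof -
  have "1 \<le> \<bar>u $ 1\<bar> + \<bar>u $ 2\<bar>"
    using norm_le_l1_cart [of u] assms(2) by (simp add: sum_2)
  then have "r * 1 \<le> r * (\<bar>u $ 1\<bar> + \<bar>u $ 2\<bar>)"
    using assms(1) by (rule mult_left_mono)
  then show ?thesis
    using assms(1) by (simp add: square_def supp_add supp_seg inner_axis abs_mult algebra_simps)
qed

text \<open>Two uses of \<open>area_add_seg\<close>; in the second, the segment already added
  produces the quadratic term. The linear term is \<open>r\<close> times the perimeter of the
  axis-parallel bounding rectangle of \<open>Y\<close>.\<close>

lemma area_add_square:
  assumes "0 \<le> r"
  shows "area (Y + square r) = area Y + 4 * r * frame_width Y + 4 * r\<^sup>2"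
proof -
  have r: "rot90 (axis 1 r) = r *\<^sub>R axis 2 1" "rot90 (axis 2 r) = (- r) *\<^sub>R axis 1 1"
    by (simp_all add: vec_eq_iff forall_2 axis_def)
  have "area (Y + square r) = area (Y + seg (axis 1 r) + seg (axis 2 r))"
    by (simp add: square_def add.assoc)
  also have "\<dots> = area Y + 4 * (r * supp Y (axis 2 1)) + 4 * (r * (supp Y (axis 1 1) + r))"
    unfolding area_add_seg r supp_scaleR supp_add supp_seg using assms by (simp add: inner_axis)
  finally show ?thesis
    by (simp add: frame_width_def algebra_simps power2_eq_square)
qed

text \<open>The bound on support functions puts \<open>X + U\<close> inside
  \<open>X + V + square r\<close>. Used in both directions, this gives continuity of the area with
  an explicit rate.\<close>

lemma area_add_close:
  assumes "0 \<le> r" "\<And>u. norm u = 1 \<Longrightarrow> supp U u \<le> supp V u + r"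
  shows "area (X + U) \<le> area (X + V) + 4 * r * (frame_width X + frame_width V) + 4 * r\<^sup>2"
proof -
  have "set_of_sbody (X + U) \<subseteq> set_of_sbody (X + V + square r)"
    using assms(2) supp_square_ge [OF assms(1)]
    by (intro subset_of_supp_le) (force simp: supp_add)
  then have "area (X + U) \<le> area (X + V + square r)"
    by (rule area_mono)
  then show ?thesis
    unfolding area_add_square [OF assms(1)] by (simp add: frame_width_def supp_add algebra_simps)
qed

text \<open>The nodes cover only the upper half circle; a vector in the lower half is replaced by
  its antipode, where even support functions take the same value.\<close>

lemma dir_net:
  fixes u :: "real^2"
  assumes "norm u = 1" "0 < N"
  obtains j where "j \<le> N"
    "norm (u - dir (real j * (pi / real N))) \<le> pi / real N \<or> norm (- u - dir (real j * (pi / real N))) \<le> pi / real N"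
proof -
  define \<delta> where "\<delta> = pi / real N"
  have \<delta>: "0 < \<delta>" "real N * \<delta> = pi" using assms(2) by (simp_all add: \<delta>_def)
  have near: "\<exists>j\<le>N. norm (dir t - dir (real j * \<delta>)) \<le> \<delta>" if "0 \<le> t" "t \<le> pi" for t
  proof (intro exI conjI)
    \<comment> \<open>The angle is rounded down to a node.\<close>
    let ?j = "nat \<lfloor>t / \<delta>\<rfloor>"
    have j: "real ?j \<le> t / \<delta>" "t / \<delta> < real ?j + 1"
      using that \<delta>(1) by (simp_all add: of_nat_nat)
    have jt: "real ?j * \<delta> \<le> t" "t < real ?j * \<delta> + \<delta>"
      using j \<delta>(1) by (simp_all add: field_simps)
    then have "real ?j * \<delta> \<le> real N * \<delta>" using jt(1) that(2) unfolding \<delta>(2) by linarith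
    then show "?j \<le> N" using \<delta>(1) by (simp del: of_nat_nat)
    show "norm (dir t - dir (real ?j * \<delta>)) \<le> \<delta>"
      using norm_dir_diff [of t "real ?j * \<delta>"] jt by linarith
  qed
  have "(u $ 1)\<^sup>2 + (u $ 2)\<^sup>2 = 1"
    using assms(1) power2_norm_eq_inner [of u] by (simp add: inner_vec2 power2_eq_square)
  then obtain t where t: "0 \<le> t" "t < 2 * pi" "u $ 1 = cos t" "u $ 2 = sin t"
    using sincos_total_2pi by metis
  then have u: "u = dir t" by (simp add: vec_eq_iff forall_2)
  show thesis
  proof (cases "t \<le> pi")
    case True
    then show ?thesis using near [of t] t that u unfolding \<delta>_def by blast
  next
    case False
    have "- u = dir (t - pi)" using dir_plus_pi [of "t - pi"] u by simp
    then show ?thesis using near [of "t - pi"] t False that unfolding \<delta>_def by force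
  qed
qed

text \<open>Move to a nearby node, where the two functions agree, and back: each move costs one
  Lipschitz constant times the step.\<close>

lemma supp_close_of_interpolation:
  assumes "0 < N" and "\<And>j. j \<le> N \<Longrightarrow> supp U (dir (real j * (pi / real N))) = supp V (dir (real j * (pi / real N)))"
    and "norm u = 1"
  shows "supp U u \<le> supp V u + (frame_width U + frame_width V) * (pi / real N)"
proof -
  have *: "supp U v \<le> supp V v + (frame_width U + frame_width V) * (pi / real N)"
    if "supp U w = supp V w" "norm (v - w) \<le> pi / real N" for v w
  proof -
    have "supp U v \<le> supp U w + supp U (v - w)"
      using supp_triangle [of U w "v - w"] by simp
    moreover have "supp V w \<le> supp V v + supp V (v - w)"
      using supp_triangle [of V v "w - v"] supp_uminus [of V "v - w"] by simp
    moreover have "supp B (v - w) \<le> frame_width B * (pi / real N)" for B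
      using that(2)
      by (intro order_trans [OF supp_le_frame_width] mult_left_mono)
        (auto simp: frame_width_def supp_nonneg)
    from this [of U] this [of V] have "supp U (v - w) + supp V (v - w) \<le> (frame_width U + frame_width V) * (pi / real N)"
      by (simp add: algebra_simps)
    ultimately show ?thesis using that(1) by linarith
  qed
  obtain j where "j \<le> N" "norm (u - dir (real j * (pi / real N))) \<le> pi / real N \<or> norm (- u - dir (real j * (pi / real N))) \<le> pi / real N"
    using dir_net [OF assms(3,1)] .
  then show ?thesis
    using * [OF assms(2), of j u] * [OF assms(2), of j "- u"] by (auto simp: supp_uminus)
qed

lemma linear_mixed_all: "linear_mixed W"
proof -
  \<comment> \<open>An even number of steps makes \<open>pi / 2\<close> a node besides
    \<open>0\<close>.\<close>
  have "\<exists>Z. linear_mixed Z \<and> (\<forall>j\<le>2 * Suc n. supp Z (dir (real j * (pi / real (2 * Suc n))))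
      = supp W (dir (real j * (pi / real (2 * Suc n)))))" for n
    using zonogon_interpolation [of "2 * Suc n" W] by (metis le_add1 mult_2 mult_Suc_right)
  then obtain Z where Z: "\<And>n. linear_mixed (Z n)"
    and supp_Z: "\<And>n j. j \<le> 2 * Suc n \<Longrightarrow> supp (Z n) (dir (real j * (pi / real (2 * Suc n))))
      = supp W (dir (real j * (pi / real (2 * Suc n))))"
    by metis
  \<comment> \<open>Both axis directions are nodes, so all \<open>Z n\<close> share the Lipschitz
    constant of \<open>W\<close>. This is why the error \<open>r n\<close> below depends on
    \<open>W\<close> and \<open>n\<close> alone and tends to zero.\<close>
  have fw: "frame_width (Z n) = frame_width W" for n
  proof -
    have "real (Suc n) * (pi / real (2 * Suc n)) = pi / 2"
      by (simp only: of_nat_mult of_nat_numeral) (simp del: of_nat_Suc)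
    then have "dir (real (Suc n) * (pi / real (2 * Suc n))) = axis 2 1"
      by (simp only:) (simp add: vec_eq_iff forall_2 axis_def)
    moreover have "dir 0 = axis 1 1"
      by (simp add: vec_eq_iff forall_2 axis_def)
    ultimately show ?thesis
      using supp_Z [of 0 n] supp_Z [of "Suc n" n] by (simp add: frame_width_def del: of_nat_Suc)
  qed
  define r where "r n = 2 * frame_width W * (pi / real (2 * Suc n))" for n
  have r_nonneg: "0 \<le> r n" for n
    by (simp add: r_def frame_width_def supp_nonneg)
  have "r = (\<lambda>n. frame_width W * pi * (1 / real (Suc n)))"
    unfolding r_def of_nat_mult of_nat_numeral by (simp del: of_nat_Suc)
  moreover have "(\<lambda>n. frame_width W * pi * (1 / real (Suc n))) \<longlonglongrightarrow> frame_width W * pi * 0"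
    by (intro tendsto_intros LIMSEQ_Suc [OF lim_1_over_n])
  ultimately have r_lim: "r \<longlonglongrightarrow> 0"
    by simp
  show ?thesis
  proof (rule linear_mixed_limit [OF Z])
    fix X
    define e where "e n = 4 * r n * (frame_width X + frame_width W) + 4 * (r n)\<^sup>2" for n
    have "e \<longlonglongrightarrow> 4 * 0 * (frame_width X + frame_width W) + 4 * 0\<^sup>2"
      unfolding e_def by (intro tendsto_intros r_lim)
    then have e: "e \<longlonglongrightarrow> 0" by simp
    have "supp (Z n) u \<le> supp W u + r n" "supp W u \<le> supp (Z n) u + r n" if "norm u = 1" for n u
      using supp_close_of_interpolation [of "2 * Suc n" "Z n" W u, OF _ supp_Z that]
        supp_close_of_interpolation [of "2 * Suc n" W "Z n" u, OF _ supp_Z [symmetric] that]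
      by (simp_all add: r_def fw)
    then have "\<bar>area (X + Z n) - area (X + W)\<bar> \<le> e n" for n
      using area_add_close [OF r_nonneg [of n], of "Z n" W X] area_add_close [OF r_nonneg [of n], of W "Z n" X]
      by (auto simp: e_def fw abs_le_iff)
    then have "(\<lambda>n. area (X + Z n) - area (X + W)) \<longlonglongrightarrow> 0"
      by (intro Lim_null_comparison [OF _ e] always_eventually) simp
    then show "(\<lambda>n. area (X + Z n)) \<longlonglongrightarrow> area (X + W)"
      by (rule LIM_zero_cancel)
  qed
qed

lemma mixed_add: "mixed (X + Y) W = mixed X W + mixed Y W" "mixed W (X + Y) = mixed W X + mixed W Y"
  using linear_mixed_all by (auto simp: linear_mixed_def mixed_commute [of W])

lemma mixed_scale: "0 \<le> c \<Longrightarrow> mixed (scale_sbody c X) W = c * mixed X W"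
  using linear_mixed_all by (simp add: linear_mixed_def)

subsection \<open>Extension to the vector space\<close>

lift_definition mixed_sdiff :: "sdiff \<Rightarrow> sdiff \<Rightarrow> real"
  is "\<lambda>(U, V) (P, Q). mixed U P - mixed U Q - mixed V P + mixed V Q"
proof clarsimp
  fix U V U' V' P Q P' Q' :: sbody
  assume "U + V' = V + U'" "P + Q' = Q + P'"
  then have "mixed U B + mixed V' B = mixed V B + mixed U' B"
    "mixed B P + mixed B Q' = mixed B Q + mixed B P'" for B
    by (metis mixed_add)+
  \<comment> \<open>Exchange the first pair against \<open>P\<close> and \<open>Q\<close>, then the
    second pair against \<open>U'\<close> and \<open>V'\<close>.\<close>
  from this(1) [of P] this(1) [of Q] this(2) [of U'] this(2) [of V']
  show "mixed U P - mixed U Q - mixed V P + mixed V Q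
    = mixed U' P' - mixed U' Q' - mixed V' P' + mixed V' Q'"
    by linarith
qed

lemma mixed_sdiff_commute: "mixed_sdiff x y = mixed_sdiff y x"
  by transfer (auto simp: mixed_commute)

lemma linear_mixed_sdiff: "linear (\<lambda>x. mixed_sdiff x z)"
proof (rule linearI)
  show "mixed_sdiff (x + y) z = mixed_sdiff x z + mixed_sdiff y z" for x y
    by transfer (auto simp: mixed_add)
  \<comment> \<open>For negative \<open>c\<close> the pair is swapped and scaled by
    \<open>- c\<close>; the alternating signs in \<open>mixed_sdiff\<close> absorb the swap.\<close>
  show "mixed_sdiff (c *\<^sub>R x) z = c *\<^sub>R mixed_sdiff x z" for c x
    by (transfer fixing: c) (auto simp: mixed_scale algebra_simps)
qed

lemma bilinear_mixed_sdiff: "bilinear mixed_sdiff"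
proof -
  have "linear (mixed_sdiff z)" for z
    using linear_mixed_sdiff [of z] by (subst (asm) mixed_sdiff_commute)
  with linear_mixed_sdiff show ?thesis
    unfolding bilinear_def by blast
qed

text \<open>Terms containing the body \<open>0\<close> vanish, and \<open>area_double\<close> leaves
  \<open>4 - 2\<close> copies of the area.\<close>

lemma mixed_sdiff_embed: "mixed_sdiff (sbody_embed U) (sbody_embed U) = 2 * area U"
  by (simp add: sbody_embed_def mixed_sdiff.abs_eq mixed_def area_double area_zero)

section \<open>Uniqueness of the extension\<close>

lemma sbody_embed_add: "sbody_embed (U + V) = sbody_embed U + sbody_embed V"
  by (simp add: sbody_embed_def plus_sdiff.abs_eq)

lemma sdiff_eq_embed_diff: "\<exists>U V. x = sbody_embed U - sbody_embed V"
proof -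
  obtain U V where "x = sdiff_class (U, V)"
    using Quotient3_abs_rep [OF Quotient3_sdiff, of x] by (metis surj_pair)
  then have "x = sbody_embed U - sbody_embed V"
    by (simp add: sbody_embed_def minus_sdiff_def plus_sdiff.abs_eq uminus_sdiff.abs_eq)
  then show ?thesis by blast
qed

lemma quadratic_polynomial_diff:
  assumes "quadratic_polynomial p" "quadratic_polynomial q"
  shows "quadratic_polynomial (\<lambda>x. p x - q x)"
proof -
  obtain b l c where p: "bilinear b" "\<forall>x y. b x y = b y x" "linear l" "\<forall>x. p x = b x x + l x + c"
    using assms(1) unfolding quadratic_polynomial_def by blast
  obtain b' l' c' where q: "bilinear b'" "\<forall>x y. b' x y = b' y x" "linear l'" "\<forall>x. q x = b' x x + l' x + c'"
    using assms(2) unfolding quadratic_polynomial_def by blast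
  show ?thesis
    unfolding quadratic_polynomial_def
  proof (intro exI conjI allI)
    show "bilinear (\<lambda>x y. b x y - b' x y)"
      using p(1) q(1) unfolding bilinear_def by (auto intro: linear_compose_sub)
    show "linear (\<lambda>x. l x - l' x)"
      using p(3) q(3) by (rule linear_compose_sub)
    show "b x y - b' x y = b y x - b' y x" for x y
      using p(2) q(2) by metis
    show "p x - q x = (b x x - b' x x) + (l x - l' x) + (c - c')" for x
      using p(4) q(4) by simp
  qed
qed

text \<open>The origin removes the constant, doubling a body separates degree one from degree two,
  polarisation reaches the mixed values of \<open>b\<close>, and differences of bodies exhaust the
  space.\<close>

lemma quadratic_polynomial_zero:
  assumes "quadratic_polynomial p" "\<And>U. p (sbody_embed U) = 0"
  shows "p x = 0"
proof -
  obtain b l c where b: "bilinear b" and sym: "\<And>x y. b x y = b y x" and l: "linear l"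
    and p: "\<And>x. p x = b x x + l x + c"
    using assms(1) unfolding quadratic_polynomial_def by blast
  have "sbody_embed 0 = 0"
    using sbody_embed_add [of 0 0] by simp
  then have "c = 0"
    using assms(2) [of 0] p [of 0] by (simp add: bilinear_lzero [OF b] linear_0 [OF l])
  \<comment> \<open>With \<open>x = sbody_embed U\<close>, the bodies \<open>U\<close> and
    \<open>U + U\<close> give \<open>b x x + l x = 0\<close> and
    \<open>4 * b x x + 2 * l x = 0\<close>.\<close>
  have z: "b (sbody_embed U) (sbody_embed U) = 0" "l (sbody_embed U) = 0" for U
    using assms(2) [of U] assms(2) [of "U + U"]
    by (simp_all add: p \<open>c = 0\<close> sbody_embed_add bilinear_ladd [OF b] bilinear_radd [OF b] linear_add [OF l])
  have z2: "b (sbody_embed U) (sbody_embed V) = 0" for U V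
    using z(1) [of "U + V"] sym [of "sbody_embed U" "sbody_embed V"]
    by (simp add: sbody_embed_add bilinear_ladd [OF b] bilinear_radd [OF b] z)
  obtain U V where "x = sbody_embed U - sbody_embed V"
    using sdiff_eq_embed_diff by blast
  then show ?thesis
    by (simp add: p \<open>c = 0\<close> bilinear_lsub [OF b] bilinear_rsub [OF b] linear_diff [OF l] z z2)
qed

theorem theorem3:
  shows "\<exists>!p :: sdiff \<Rightarrow> real. quadratic_polynomial p \<and>
    (\<forall>U. p (sbody_embed U) = measure lebesgue (set_of_sbody U))"
proof (rule ex_ex1I)
  \<comment> \<open>Halving compensates the factor in \<open>mixed_sdiff_embed\<close>; the
    extension is a pure quadratic form.\<close>
  have "quadratic_polynomial (\<lambda>x. mixed_sdiff x x / 2)"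
    unfolding quadratic_polynomial_def
  proof (intro exI conjI allI)
    show "bilinear (\<lambda>x y. mixed_sdiff x y / 2)"
      unfolding bilinear_def using bilinear_mixed_sdiff
      by (auto intro!: linearI simp: bilinear_ladd bilinear_radd bilinear_lmul bilinear_rmul add_divide_distrib)
    show "linear (\<lambda>x :: sdiff. 0 :: real)" by (rule linear_zero)
    show "mixed_sdiff x y / 2 = mixed_sdiff y x / 2" for x y
      by (simp add: mixed_sdiff_commute)
    show "mixed_sdiff x x / 2 = mixed_sdiff x x / 2 + 0 + 0" for x
      by simp
  qed
  then show "\<exists>p :: sdiff \<Rightarrow> real. quadratic_polynomial p \<and>
      (\<forall>U. p (sbody_embed U) = measure lebesgue (set_of_sbody U))"
    by (intro exI [of _ "\<lambda>x. mixed_sdiff x x / 2"]) (simp add: mixed_sdiff_embed)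
next
  fix p q :: "sdiff \<Rightarrow> real"
  assume "quadratic_polynomial p \<and> (\<forall>U. p (sbody_embed U) = measure lebesgue (set_of_sbody U))"
    "quadratic_polynomial q \<and> (\<forall>U. q (sbody_embed U) = measure lebesgue (set_of_sbody U))"
  then show "p = q"
    using quadratic_polynomial_zero [OF quadratic_polynomial_diff [of p q]]
    by (auto simp: fun_eq_iff)
qed

end
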